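(* Let $P_i=N_iD_i^{-1}$, $i=0,1$, be two different $m\times m$ plants with $N_i,D_i\in\mathbb{H}^{m\times m}$ right coprime, and set $$M(s)=\begin{bmatrix}N_0(s)&N_1(s)\\ D_0(s)&D_1(s)\end{bmatrix}.$$ Assume that $\det M(\infty)\neq0$ and that the zeros $s_1,\dots,s_t$ of $\det M(s)$ in $\mathbb{C}_+$ are all simple. Then $P_0$ and $P_1$ can be simultaneously stabilized by a (single) proper compensator if and only if there exist $\Delta_0,\Delta_1\in\mathbb{H}^{m\times m}$ with $\det\Delta_0,\det\Delta_1\in\mathbb{J}$ such that $$\begin{bmatrix}\Delta_0(s)&\Delta_1(s)\end{bmatrix}\operatorname{Adj}(M(s))=\mathbf{0}\qquad\text{at } s=s_1,s_2,\dots,s_t.$$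
   Context: $\mathbb{C}_-$ is the open left half of the complex plane and $\mathbb{C}_+=(\mathbb{C}\setminus\mathbb{C}_-)\cup\{\infty\}$. $\mathbb{H}$ is the ring of proper rational functions in $s$ with real coefficients all of whose poles lie in $\mathbb{C}_-$, $\mathbb{H}^{m\times m}$ is the set of $m\times m$ matrices with entries in $\mathbb{H}$, and $\mathbb{J}$ is the set of multiplicative units of $\mathbb{H}$. $\operatorname{Adj}$ denotes the adjugate (classical adjoint) matrix. Coprimeness is over $\mathbb{H}$. A compensator is an $m\times m$ rational matrix $K=D_c^{-1}N_c$ with $N_c,D_c\in\mathbb{H}^{m\times m}$ (left) coprime; it is proper if its entries are proper rational functions. $K$ stabilizes $P_i=N_iD_i^{-1}$ if and only if $N_cN_i+D_cD_i=\Delta_i$ for some $\Delta_i\in\mathbb{H}^{m\times m}$ with $\det\Delta_i\in\mathbb{J}$ (this is taken as the definition of stabilization). $K$ simultaneously stabilizes $P_0$ and $P_1$ if it stabilizes both. *)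

theory Defs
  imports
    "Jordan_Normal_Form.Determinant"
    "HOL-Computational_Algebra.Polynomial_Factorial"
    "HOL-Computational_Algebra.Normalized_Fraction"
    "HOL-Computational_Algebra.Field_as_Ring"
    Complex_Main
begin

section \<open>Real rational functions and their values on the extended plane\<close>

type_synonym ratfun = "real poly fract"

datatype cpoint = Fin complex | Infinity

text \<open>Numerator and (monic) denominator in lowest terms, seen as complex polynomials.\<close>

definition numer :: "ratfun \<Rightarrow> complex poly" where
  "numer r = map_poly complex_of_real (fst (quot_of_fract r))"

definition denom :: "ratfun \<Rightarrow> complex poly" where
  "denom r = map_poly complex_of_real (snd (quot_of_fract r))"

definition proper :: "ratfun \<Rightarrow> bool" where
  "proper r \<longleftrightarrow> degree (numer r) \<le> degree (denom r)"

definition finite_poles :: "ratfun \<Rightarrow> complex set" where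
  "finite_poles r = {z. poly (denom r) z = 0}"

text \<open>The value is meaningful only away from the poles (at infinity: only for proper functions);
  elsewhere it is a dummy. At infinity it is the limit: the ratio of the leading coefficients,
  or 0 if the function is strictly proper.\<close>

fun rat_eval :: "ratfun \<Rightarrow> cpoint \<Rightarrow> complex" where
  "rat_eval r (Fin z) = poly (numer r) z / poly (denom r) z"
| "rat_eval r Infinity = coeff (numer r) (degree (denom r)) / lead_coeff (denom r)"

text \<open>Multiplicity of a zero of a nonzero function; at infinity it is the relative degree.\<close>

fun zero_multiplicity :: "ratfun \<Rightarrow> cpoint \<Rightarrow> nat" where
  "zero_multiplicity r (Fin z) = order z (numer r)"
| "zero_multiplicity r Infinity = degree (denom r) - degree (numer r)"

definition C_minus :: "complex set" where
  "C_minus = {z. Re z < 0}"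

definition C_plus :: "cpoint set" where
  "C_plus = Fin ` (UNIV - C_minus) \<union> {Infinity}"

definition zeros_in_C_plus :: "ratfun \<Rightarrow> cpoint set" where
  "zeros_in_C_plus r = {s \<in> C_plus. rat_eval r s = 0}"


section \<open>The ring of proper stable functions and its matrices\<close>

definition HH :: "ratfun set" where
  "HH = {r. proper r \<and> finite_poles r \<subseteq> C_minus}"

definition JJ :: "ratfun set" where
  "JJ = {u \<in> HH. \<exists>v \<in> HH. u * v = 1}"

definition HH_mat :: "nat \<Rightarrow> ratfun mat set" where
  "HH_mat m = {A \<in> carrier_mat m m. elements_mat A \<subseteq> HH}"

definition unimodular :: "nat \<Rightarrow> ratfun mat \<Rightarrow> bool" where
  "unimodular m A \<longleftrightarrow> A \<in> HH_mat m \<and> det A \<in> JJ"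

definition proper_mat :: "ratfun mat \<Rightarrow> bool" where
  "proper_mat A \<longleftrightarrow> (\<forall>r \<in> elements_mat A. proper r)"

abbreviation eval_mat :: "ratfun mat \<Rightarrow> cpoint \<Rightarrow> complex mat" where
  "eval_mat A s \<equiv> map_mat (\<lambda>r. rat_eval r s) A"

text \<open>The block row \<open>[A B]\<close>, the column counterpart of \<open>append_rows\<close>.\<close>

definition append_cols :: "'a :: zero mat \<Rightarrow> 'a mat \<Rightarrow> 'a mat" where
  "append_cols A B = four_block_mat A B (0\<^sub>m 0 (dim_col A)) (0\<^sub>m 0 (dim_col B))"


section \<open>Coprime factorizations and stabilization\<close>

text \<open>Coprimeness over the ring: every common divisor is unimodular.\<close>

definition right_coprime :: "nat \<Rightarrow> ratfun mat \<Rightarrow> ratfun mat \<Rightarrow> bool" where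
  "right_coprime m N D \<longleftrightarrow>
     (\<forall>A \<in> HH_mat m. \<forall>B \<in> HH_mat m. \<forall>R \<in> HH_mat m.
        N = A * R \<and> D = B * R \<longrightarrow> unimodular m R)"

definition left_coprime :: "nat \<Rightarrow> ratfun mat \<Rightarrow> ratfun mat \<Rightarrow> bool" where
  "left_coprime m N D \<longleftrightarrow>
     (\<forall>A \<in> HH_mat m. \<forall>B \<in> HH_mat m. \<forall>L \<in> HH_mat m.
        N = L * A \<and> D = L * B \<longrightarrow> unimodular m L)"

text \<open>\<open>P = N D\<^sup>-\<^sup>1\<close>, respectively \<open>K = D\<^sup>-\<^sup>1 N\<close>, where the inverse \<open>E\<close> of \<open>D\<close>
  is taken over the field of rational functions.\<close>

definition right_coprime_factorization ::
  "nat \<Rightarrow> ratfun mat \<Rightarrow> ratfun mat \<Rightarrow> ratfun mat \<Rightarrow> bool" where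
  "right_coprime_factorization m P N D \<longleftrightarrow>
     N \<in> HH_mat m \<and> D \<in> HH_mat m \<and> right_coprime m N D \<and>
     (\<exists>E \<in> carrier_mat m m. inverts_mat D E \<and> inverts_mat E D \<and> P = N * E)"

definition left_coprime_factorization ::
  "nat \<Rightarrow> ratfun mat \<Rightarrow> ratfun mat \<Rightarrow> ratfun mat \<Rightarrow> bool" where
  "left_coprime_factorization m K N D \<longleftrightarrow>
     N \<in> HH_mat m \<and> D \<in> HH_mat m \<and> left_coprime m N D \<and>
     (\<exists>E \<in> carrier_mat m m. inverts_mat D E \<and> inverts_mat E D \<and> K = E * N)"

definition compensator :: "nat \<Rightarrow> ratfun mat \<Rightarrow> bool" where
  "compensator m K \<longleftrightarrow> (\<exists>Nc Dc. left_coprime_factorization m K Nc Dc)"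

text \<open>The choice of the coprime factorizations is immaterial; see \<open>stabilizes_iff\<close> below.\<close>

definition stabilizes :: "nat \<Rightarrow> ratfun mat \<Rightarrow> ratfun mat \<Rightarrow> bool" where
  "stabilizes m K P \<longleftrightarrow>
     (\<exists>Nc Dc N D. left_coprime_factorization m K Nc Dc \<and> right_coprime_factorization m P N D \<and>
        unimodular m (Nc * N + Dc * D))"

definition simultaneously_stabilizes ::
  "nat \<Rightarrow> ratfun mat \<Rightarrow> ratfun mat \<Rightarrow> ratfun mat \<Rightarrow> bool" where
  "simultaneously_stabilizes m K P0 P1 \<longleftrightarrow> stabilizes m K P0 \<and> stabilizes m K P1"


section \<open>Independence of the factorizations\<close>

lemma map_of_real_mult:
  "map_poly complex_of_real (p * q) = map_poly complex_of_real p * map_poly complex_of_real q"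
  by (rule poly_eqI) (simp add: coeff_map_poly coeff_mult)

lemma HH_iff:
  "r \<in> HH \<longleftrightarrow> (\<exists>a b. b \<noteq> 0 \<and> r = Fraction_Field.Fract a b \<and> degree a \<le> degree b \<and>
     (\<forall>z. poly (map_poly complex_of_real b) z = 0 \<longrightarrow> Re z < 0))" (is "_ \<longleftrightarrow> ?R")
proof
  assume "r \<in> HH"
  then show ?R
    by (intro exI[of _ "fst (quot_of_fract r)"] exI[of _ "snd (quot_of_fract r)"])
      (auto simp: HH_def proper_def numer_def denom_def finite_poles_def C_minus_def degree_map_poly)
next
  assume ?R
  then obtain a b where b: "b \<noteq> 0" and r: "r = Fraction_Field.Fract a b"
    and deg: "degree a \<le> degree b"
    and st: "\<And>z. poly (map_poly complex_of_real b) z = 0 \<Longrightarrow> Re z < 0" by blast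
  define n where "n = fst (quot_of_fract r)"
  define d where "d = snd (quot_of_fract r)"
  have d0: "d \<noteq> 0" by (simp add: d_def)
  have "Fraction_Field.Fract n d = Fraction_Field.Fract a b"
    by (simp add: n_def d_def r)
  then have eq: "n * b = a * d" using b d0 by (simp add: eq_fract)
  have cop: "coprime d n" unfolding n_def d_def
    using coprime_quot_of_fract[of r] by (simp add: coprime_commute)
  from eq have "d dvd n * b" by simp
  then have "d dvd b" using cop by (simp add: coprime_dvd_mult_right_iff)
  then obtain c where c: "b = d * c" by blast
  have a: "a = n * c" using eq c d0 by (simp add: mult.assoc mult.left_commute)
  have c0: "c \<noteq> 0" using b c by auto
  have "degree n \<le> degree d"
  proof (cases "n = 0")
    case False
    then show ?thesis using deg a c c0 d0 by (simp add: degree_mult_eq)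
  qed simp
  moreover have "Re z < 0" if "poly (map_poly complex_of_real d) z = 0" for z
  proof (rule st)
    show "poly (map_poly complex_of_real b) z = 0" using that by (simp add: c map_of_real_mult)
  qed
  ultimately show "r \<in> HH"
    by (auto simp: HH_def proper_def numer_def denom_def finite_poles_def C_minus_def
        n_def d_def degree_map_poly)
qed

lemma HH_0: "0 \<in> HH" and HH_1: "1 \<in> HH"
  by (auto simp: HH_def proper_def numer_def denom_def finite_poles_def C_minus_def)

lemma HH_add: assumes "x \<in> HH" "y \<in> HH" shows "x + y \<in> HH"
proof -
  from assms obtain a b c d where
    *: "b \<noteq> 0" "x = Fraction_Field.Fract a b" "degree a \<le> degree b"
      "d \<noteq> 0" "y = Fraction_Field.Fract c d" "degree c \<le> degree d"
    and st: "\<forall>z. poly (map_poly complex_of_real b) z = 0 \<longrightarrow> Re z < 0"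
      "\<forall>z. poly (map_poly complex_of_real d) z = 0 \<longrightarrow> Re z < 0"
    unfolding HH_iff by blast
  have "degree (a * d + c * b) \<le> degree (b * d)"
    using * degree_mult_le[of a d] degree_mult_le[of c b]
    by (intro degree_add_le) (auto simp: degree_mult_eq)
  then show ?thesis unfolding HH_iff using * st
    by (intro exI[of _ "a * d + c * b"] exI[of _ "b * d"]) (auto simp: map_of_real_mult)
qed

lemma HH_mult: assumes "x \<in> HH" "y \<in> HH" shows "x * y \<in> HH"
proof -
  from assms obtain a b c d where
    *: "b \<noteq> 0" "x = Fraction_Field.Fract a b" "degree a \<le> degree b"
      "d \<noteq> 0" "y = Fraction_Field.Fract c d" "degree c \<le> degree d"
    and st: "\<forall>z. poly (map_poly complex_of_real b) z = 0 \<longrightarrow> Re z < 0"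
      "\<forall>z. poly (map_poly complex_of_real d) z = 0 \<longrightarrow> Re z < 0"
    unfolding HH_iff by blast
  have "degree (a * c) \<le> degree (b * d)"
    using * degree_mult_le[of a c] by (auto simp: degree_mult_eq)
  then show ?thesis unfolding HH_iff using * st
    by (intro exI[of _ "a * c"] exI[of _ "b * d"]) (auto simp: map_of_real_mult)
qed

lemma HH_uminus: assumes "x \<in> HH" shows "- x \<in> HH"
proof -
  from assms obtain a b where
    "b \<noteq> 0" "x = Fraction_Field.Fract a b" "degree a \<le> degree b"
    "\<forall>z. poly (map_poly complex_of_real b) z = 0 \<longrightarrow> Re z < 0"
    unfolding HH_iff by blast
  then show ?thesis unfolding HH_iff
    by (intro exI[of _ "- a"] exI[of _ b]) auto
qed

lemma HH_sum: "(\<And>i. i \<in> I \<Longrightarrow> f i \<in> HH) \<Longrightarrow> sum f I \<in> HH"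
  by (induction I rule: infinite_finite_induct) (auto simp: HH_0 HH_add)

lemma HH_prod: "(\<And>i. i \<in> I \<Longrightarrow> f i \<in> HH) \<Longrightarrow> prod f I \<in> HH"
  by (induction I rule: infinite_finite_induct) (auto simp: HH_1 HH_mult)

lemma HH_power: "x \<in> HH \<Longrightarrow> x ^ n \<in> HH"
  by (induction n) (auto simp: HH_1 HH_mult)

lemma HH_mat_iff:
  "A \<in> HH_mat m \<longleftrightarrow> A \<in> carrier_mat m m \<and> (\<forall>i < m. \<forall>j < m. A $$ (i, j) \<in> HH)"
proof -
  have "elements_mat A \<subseteq> HH \<longleftrightarrow> (\<forall>i < m. \<forall>j < m. A $$ (i, j) \<in> HH)"
    if "A \<in> carrier_mat m m"
    using carrier_matD[OF that] by (force simp: elements_mat_def)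
  then show ?thesis unfolding HH_mat_def by blast
qed

lemma HH_mat_add: "A \<in> HH_mat m \<Longrightarrow> B \<in> HH_mat m \<Longrightarrow> A + B \<in> HH_mat m"
  by (auto simp: HH_mat_iff HH_add)

lemma HH_mat_mult: "A \<in> HH_mat m \<Longrightarrow> B \<in> HH_mat m \<Longrightarrow> A * B \<in> HH_mat m"
  by (auto simp: HH_mat_iff scalar_prod_def intro!: HH_sum HH_mult)

lemma det_HH: assumes "A \<in> HH_mat m" shows "det A \<in> HH"
proof -
  have s: "signof p \<in> HH" for p :: "nat \<Rightarrow> nat"
    by (auto simp: sign_def HH_1 HH_uminus)
  have A: "A \<in> carrier_mat m m" and H: "\<And>i j. i < m \<Longrightarrow> j < m \<Longrightarrow> A $$ (i, j) \<in> HH"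
    using assms by (auto simp: HH_mat_iff)
  have "(\<Prod>i = 0..<m. A $$ (i, p i)) \<in> HH" if "p permutes {0..<m}" for p
    using permutes_in_image[OF that] by (intro HH_prod H) auto
  then show ?thesis
    unfolding det_def'[OF A] by (intro HH_sum HH_mult s) auto
qed

lemma adj_mat_HH: assumes A: "A \<in> HH_mat m" shows "adj_mat A \<in> HH_mat m"
proof -
  have "cofactor A i j \<in> HH" if ij: "i < m" "j < m" for i j
  proof -
    have "mat_delete A i j \<in> HH_mat (m - 1)"
      using A by (auto simp: HH_mat_iff mat_delete_def)
    then show ?thesis
      by (simp add: cofactor_def HH_mult HH_power HH_uminus HH_1 det_HH)
  qed
  then show ?thesis using A by (auto simp: HH_mat_iff adj_mat_def)
qed

lemma JJ_mult: assumes "x \<in> JJ" "y \<in> JJ" shows "x * y \<in> JJ"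
proof -
  from assms obtain u v where xy: "x \<in> HH" "y \<in> HH" and uv: "u \<in> HH" "v \<in> HH"
    and 1: "x * u = 1" "y * v = 1"
    by (auto simp: JJ_def)
  have "(x * y) * (u * v) = (x * u) * (y * v)" by (simp only: mult.assoc mult.left_commute)
  then have "(x * y) * (u * v) = 1" by (simp only: 1 mult_1_right)
  then show ?thesis unfolding JJ_def using HH_mult[OF xy] HH_mult[OF uv] by blast
qed

lemma unimodular_mult:
  assumes "unimodular m A" "unimodular m B" shows "unimodular m (A * B)"
proof -
  have "A \<in> carrier_mat m m" "B \<in> carrier_mat m m"
    using assms by (auto simp: unimodular_def HH_mat_def)
  then show ?thesis
    using assms by (auto simp: unimodular_def HH_mat_mult det_mult JJ_mult)
qed

lemma unimodular_inverse:
  assumes A: "unimodular m A"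
  obtains B where "B \<in> HH_mat m" "A * B = 1\<^sub>m m" "B * A = 1\<^sub>m m"
proof -
  from A obtain v where v: "v \<in> HH" "det A * v = 1" and AH: "A \<in> HH_mat m"
    by (auto simp: unimodular_def JJ_def)
  have Ac: "A \<in> carrier_mat m m" using AH by (simp add: HH_mat_def)
  define B where "B = v \<cdot>\<^sub>m adj_mat A"
  have Jc: "adj_mat A \<in> carrier_mat m m" using adj_mat[OF Ac] by blast
  have one: "v \<cdot>\<^sub>m (det A \<cdot>\<^sub>m 1\<^sub>m m) = 1\<^sub>m m"
    using v(2) by (intro eq_matI) (auto simp: mult.commute)
  have "B \<in> HH_mat m" using adj_mat_HH[OF AH] v by (auto simp: B_def HH_mat_iff HH_mult)
  moreover have "A * B = 1\<^sub>m m" "B * A = 1\<^sub>m m"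
    using adj_mat(2,3)[OF Ac] one
    by (simp_all add: B_def mult_smult_distrib[OF Ac Jc] mult_smult_assoc_mat[OF Jc Ac])
  ultimately show ?thesis using that by blast
qed

lemma stabilizes_iff:
  assumes K: "left_coprime_factorization m K Nc Dc"
    and P: "right_coprime_factorization m P N D"
  shows "stabilizes m K P \<longleftrightarrow> unimodular m (Nc * N + Dc * D)"
proof
  assume "unimodular m (Nc * N + Dc * D)"
  then show "stabilizes m K P" using K P unfolding stabilizes_def by blast
next
  assume "stabilizes m K P"
  then obtain Nc' Dc' N' D' where K': "left_coprime_factorization m K Nc' Dc'"
    and P': "right_coprime_factorization m P N' D'"
    and T: "unimodular m (Nc' * N' + Dc' * D')" unfolding stabilizes_def by blast
  define T' where "T' = Nc' * N' + Dc' * D'"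
  have H: "Nc \<in> HH_mat m" "Dc \<in> HH_mat m" "N \<in> HH_mat m" "D \<in> HH_mat m"
    "Nc' \<in> HH_mat m" "Dc' \<in> HH_mat m" "N' \<in> HH_mat m" "D' \<in> HH_mat m" "T' \<in> HH_mat m"
    using K P K' P' T
    by (auto simp: left_coprime_factorization_def right_coprime_factorization_def T'_def
        unimodular_def)
  then have C: "Nc \<in> carrier_mat m m" "Dc \<in> carrier_mat m m" "N \<in> carrier_mat m m"
    "D \<in> carrier_mat m m" "Nc' \<in> carrier_mat m m" "Dc' \<in> carrier_mat m m"
    "N' \<in> carrier_mat m m" "D' \<in> carrier_mat m m" "T' \<in> carrier_mat m m"
    by (auto simp: HH_mat_def)
  obtain E where E: "E \<in> carrier_mat m m" "D * E = 1\<^sub>m m" "E * D = 1\<^sub>m m" "P = N * E"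
    using P C by (auto simp: right_coprime_factorization_def inverts_mat_def)
  obtain E' where E': "E' \<in> carrier_mat m m" "D' * E' = 1\<^sub>m m" "E' * D' = 1\<^sub>m m" "P = N' * E'"
    using P' C by (auto simp: right_coprime_factorization_def inverts_mat_def)
  obtain F where F: "F \<in> carrier_mat m m" "Dc * F = 1\<^sub>m m" "F * Dc = 1\<^sub>m m" "K = F * Nc"
    using K C by (auto simp: left_coprime_factorization_def inverts_mat_def)
  obtain F' where F': "F' \<in> carrier_mat m m" "Dc' * F' = 1\<^sub>m m" "F' * Dc' = 1\<^sub>m m"
    "K = F' * Nc'"
    using K' C by (auto simp: left_coprime_factorization_def inverts_mat_def)
  obtain S where S: "S \<in> HH_mat m" "T' * S = 1\<^sub>m m" "S * T' = 1\<^sub>m m"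
    using unimodular_inverse T unfolding T'_def by blast
  have Sc: "S \<in> carrier_mat m m" using S by (simp add: HH_mat_def)
  note assoc = assoc_mult_mat[of _ m m _ m _ m]
  define V where "V = E' * D"
  define U where "U = Dc * F'"
  have VC: "V \<in> carrier_mat m m" and UC: "U \<in> carrier_mat m m"
    using C E' F' by (auto simp: V_def U_def)
  have DV: "D' * V = D"
    using C E E' by (simp add: V_def assoc[symmetric])
  have NV: "N' * V = N"
  proof -
    have "N' * V = P * D" using C E' by (simp add: V_def assoc)
    also have "\<dots> = N * (E * D)" using C E by (simp add: assoc)
    finally show ?thesis using C E by simp
  qed
  have DU: "U * Dc' = Dc"
    using C F F' by (simp add: U_def assoc)
  have NU: "U * Nc' = Nc"
  proof -
    have "U * Nc' = Dc * K" using C F' by (simp add: U_def assoc)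
    also have "\<dots> = (Dc * F) * Nc" unfolding F(4) using C F(1) by (simp add: assoc)
    finally show ?thesis using C F by simp
  qed
  have TV: "T' * V = Nc' * N + Dc' * D"
    using C VC by (simp add: T'_def add_mult_distrib_mat[of _ m m _ _ m] assoc DV NV)
  have UT: "U * T' = Nc * N' + Dc * D'"
    using C UC by (simp add: T'_def mult_add_distrib_mat[of _ m m _ m] assoc[symmetric] DU NU)
  have "V = S * (T' * V)" using C VC Sc S by (simp add: assoc[symmetric])
  then have VH: "V \<in> HH_mat m" unfolding TV using H S by (metis HH_mat_add HH_mat_mult)
  have "U = U * T' * S" using C UC Sc S by (simp add: assoc)
  then have UH: "U \<in> HH_mat m" unfolding UT using H S by (metis HH_mat_add HH_mat_mult)
  have V: "unimodular m V"
    using P VH H NV DV unfolding right_coprime_factorization_def right_coprime_def by metis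
  have U: "unimodular m U"
    using K UH H NU DU unfolding left_coprime_factorization_def left_coprime_def by metis
  have "U * T' * V = Nc * N' * V + Dc * D' * V"
    unfolding UT using C VC by (simp add: add_mult_distrib_mat[of _ m m _ _ m])
  also have "\<dots> = Nc * N + Dc * D" using C VC by (simp add: assoc NV DV)
  finally show "unimodular m (Nc * N + Dc * D)"
    using unimodular_mult[OF unimodular_mult[OF U] V] T unfolding T'_def by metis
qed

end

theory Submission
  imports Defs "Jordan_Normal_Form.Char_Poly"
begin

text \<open>A compensator \<open>K = Dc\<^sup>-\<^sup>1 Nc\<close> stabilizes both plants iff \<open>[Nc Dc] M = [\<Delta>0 \<Delta>1]\<close> with unimodular
  \<open>\<Delta>0\<close>, \<open>\<Delta>1\<close>. Multiplying by the adjugate gives \<open>det M [Nc Dc] = [\<Delta>0 \<Delta>1] Adj M\<close>, which yields the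
  interpolation conditions. Conversely, since the unstable zeros of \<open>det M\<close> are simple and finite,
  the conditions make \<open>[\<Delta>0 \<Delta>1] Adj M\<close> divisible by \<open>det M\<close> over the ring, and the quotient is
  \<open>[Nc Dc]\<close>. The matrix \<open>Dc\<close> so obtained may be singular at infinity. Replacing it by
  \<open>Dc + \<epsilon> I\<close> changes \<open>\<Delta>i\<close> to \<open>\<Delta>i + \<epsilon> Di\<close>, which remains unimodular for small \<open>\<epsilon>\<close>, because elements
  of the ring are bounded on the extended closed right half plane; and all but finitely many \<open>\<epsilon>\<close>
  make \<open>Dc + \<epsilon> I\<close> invertible at infinity, so that \<open>K\<close> exists and is proper.\<close>

section \<open>Evaluation through homogenized polynomials\<close>

declare rat_eval.simps [simp del]

lemma map_of_real_add:
  "map_poly complex_of_real (p + q) = map_poly complex_of_real p + map_poly complex_of_real q"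
  by (rule poly_eqI) (simp add: coeff_map_poly)

text \<open>Homogenized evaluation of a polynomial of degree at most \<open>k\<close>, which treats the
  finite points and the point at infinity alike.\<close>

definition poly_at :: "cpoint \<Rightarrow> nat \<Rightarrow> real poly \<Rightarrow> complex" where
  "poly_at s k p = (case s of Fin z \<Rightarrow> poly (map_poly complex_of_real p) z
     | Infinity \<Rightarrow> complex_of_real (coeff p k))"

lemma poly_at_add: "poly_at s k (p + q) = poly_at s k p + poly_at s k q"
  by (simp add: poly_at_def map_of_real_add split: cpoint.split)

text \<open>At \<open>Infinity\<close> only the pair of coefficients at \<open>i\<close> and
  \<open>j\<close> can contribute to the coefficient at \<open>i + j\<close>. If one of the degrees
  is below its bound, both sides vanish there.\<close>

lemma poly_at_mult:
  assumes "degree p \<le> i" "degree q \<le> j"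
  shows "poly_at s (i + j) (p * q) = poly_at s i p * poly_at s j q"
proof -
  have "coeff (p * q) (i + j) = coeff p i * coeff q j"
  proof (cases "i = degree p \<and> j = degree q")
    case True
    then show ?thesis by (simp add: coeff_mult_degree_sum)
  next
    case False
    then have "degree (p * q) < i + j" "coeff p i * coeff q j = 0"
      using assms degree_mult_le[of p q] by (auto intro!: coeff_eq_0)
    then show ?thesis by (simp add: coeff_eq_0)
  qed
  then show ?thesis by (simp add: poly_at_def map_of_real_mult split: cpoint.split)
qed

text \<open>These are the denominators allowed in \<open>HH\<close>. Working with them avoids
  reducing fractions to lowest terms after each ring operation.\<close>

definition stable_poly :: "real poly \<Rightarrow> bool" where
  "stable_poly b \<longleftrightarrow> b \<noteq> 0 \<and> (\<forall>z. poly (map_poly complex_of_real b) z = 0 \<longrightarrow> Re z < 0)"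

lemma stable_poly_mult: "stable_poly b \<Longrightarrow> stable_poly d \<Longrightarrow> stable_poly (b * d)"
  by (auto simp: stable_poly_def map_of_real_mult)

lemma HH_iff_stable:
  "r \<in> HH \<longleftrightarrow> (\<exists>a b. stable_poly b \<and> r = Fraction_Field.Fract a b \<and> degree a \<le> degree b)"
  unfolding HH_iff stable_poly_def by blast

lemma poly_at_stable: "s \<in> C_plus \<Longrightarrow> stable_poly b \<Longrightarrow> poly_at s (degree b) b \<noteq> 0"
  by (auto simp: poly_at_def stable_poly_def C_plus_def C_minus_def split: cpoint.split)

lemma HH_quot_of_fract:
  assumes "r \<in> HH"
  shows "stable_poly (snd (quot_of_fract r))"
    "degree (fst (quot_of_fract r)) \<le> degree (snd (quot_of_fract r))"
  using assms by (auto simp: HH_def stable_poly_def proper_def numer_def denom_def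
      finite_poles_def C_minus_def degree_map_poly)

text \<open>With the degree of the denominator as the formal degree of both polynomials, the two
  cases of \<open>rat_eval\<close> become one quotient.\<close>

lemma rat_eval_poly_at:
  "rat_eval r s = poly_at s (degree (snd (quot_of_fract r))) (fst (quot_of_fract r)) /
     poly_at s (degree (snd (quot_of_fract r))) (snd (quot_of_fract r))"
  by (cases s) (simp_all add: rat_eval.simps poly_at_def numer_def denom_def coeff_map_poly degree_map_poly)

text \<open>Any stable proper representation may be used for evaluation, reduced or not: the
  cross-multiplied identity with the reduced form is evaluated by \<open>poly_at_mult\<close>, and
  stable denominators do not vanish on \<open>C_plus\<close>.\<close>

lemma rat_eval_Fract:
  assumes s: "s \<in> C_plus" and b: "stable_poly b" and deg: "degree a \<le> degree b"
  shows "rat_eval (Fraction_Field.Fract a b) s = poly_at s (degree b) a / poly_at s (degree b) b"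
proof -
  define r where "r = Fraction_Field.Fract a b"
  define n where "n = fst (quot_of_fract r)"
  define d where "d = snd (quot_of_fract r)"
  have r: "r \<in> HH" using b deg unfolding HH_iff_stable r_def by blast
  have d: "stable_poly d" "degree n \<le> degree d"
    using HH_quot_of_fract[OF r] by (simp_all add: n_def d_def)
  have "Fraction_Field.Fract n d = Fraction_Field.Fract a b"
    by (simp add: n_def d_def r_def)
  then have "n * b = a * d" using b d by (simp add: eq_fract stable_poly_def)
  then have "poly_at s (degree d + degree b) (n * b) = poly_at s (degree b + degree d) (a * d)"
    by (simp add: add.commute)
  then have "poly_at s (degree d) n * poly_at s (degree b) b =
      poly_at s (degree b) a * poly_at s (degree d) d"
    using d deg by (simp add: poly_at_mult)
  then have "poly_at s (degree d) n / poly_at s (degree d) d =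
      poly_at s (degree b) a / poly_at s (degree b) b"
    using poly_at_stable[OF s b] poly_at_stable[OF s d(1)] by (simp add: frac_eq_eq)
  then show ?thesis unfolding rat_eval_poly_at n_def d_def r_def .
qed

lemma rat_eval_const: "s \<in> C_plus \<Longrightarrow> rat_eval (to_fract [:c:]) s = of_real c"
  and HH_const: "to_fract [:c:] \<in> HH"
proof -
  have 1: "stable_poly 1" by (simp add: stable_poly_def)
  show "to_fract [:c:] \<in> HH" using 1 unfolding HH_iff_stable to_fract_def
    by (intro exI[of _ "[:c:]"] exI[of _ 1]) auto
  show "rat_eval (to_fract [:c:]) s = of_real c" if "s \<in> C_plus"
  proof -
    have "map_poly complex_of_real [:c:] = [:of_real c:]"
      by (rule poly_eqI) (simp add: coeff_map_poly coeff_pCons split: nat.split)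
    then show ?thesis using rat_eval_Fract[OF that 1, of "[:c:]"]
      by (simp add: to_fract_def poly_at_def split: cpoint.splits)
  qed
qed

lemma rat_eval_0: "rat_eval 0 s = 0"
  by (cases s) (simp_all add: rat_eval.simps numer_def)

lemma rat_eval_1: "rat_eval 1 s = 1"
  by (cases s) (simp_all add: rat_eval.simps numer_def denom_def)

section \<open>Evaluation at a point of \<open>C_plus\<close> as a ring homomorphism on
  \<open>HH\<close>\<close>

context
  fixes s :: cpoint assumes s: "s \<in> C_plus"
begin

lemma rat_eval_mult:
  assumes "x \<in> HH" "y \<in> HH" shows "rat_eval (x * y) s = rat_eval x s * rat_eval y s"
proof -
  from assms obtain a b c d where
    *: "stable_poly b" "x = Fraction_Field.Fract a b" "degree a \<le> degree b"
      "stable_poly d" "y = Fraction_Field.Fract c d" "degree c \<le> degree d"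
    unfolding HH_iff_stable by blast
  have "degree (b * d) = degree b + degree d"
    using * by (simp add: stable_poly_def degree_mult_eq)
  moreover have "degree (a * c) \<le> degree b + degree d"
    using * degree_mult_le[of a c] by linarith
  ultimately have "rat_eval (Fraction_Field.Fract (a * c) (b * d)) s =
      poly_at s (degree b + degree d) (a * c) / poly_at s (degree b + degree d) (b * d)"
    using rat_eval_Fract[OF s stable_poly_mult[OF *(1,4)], of "a * c"] by simp
  then show ?thesis using * rat_eval_Fract[OF s, of b a] rat_eval_Fract[OF s, of d c]
    by (simp add: poly_at_mult)
qed

lemma rat_eval_add:
  assumes "x \<in> HH" "y \<in> HH" shows "rat_eval (x + y) s = rat_eval x s + rat_eval y s"
proof -
  from assms obtain a b c d where
    *: "stable_poly b" "x = Fraction_Field.Fract a b" "degree a \<le> degree b"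
      "stable_poly d" "y = Fraction_Field.Fract c d" "degree c \<le> degree d"
    unfolding HH_iff_stable by blast
  have "b \<noteq> 0" "d \<noteq> 0" using * by (auto simp: stable_poly_def)
  then have "degree (b * d) = degree b + degree d" by (simp add: degree_mult_eq)
  moreover have "degree (a * d + c * b) \<le> degree b + degree d"
    using * degree_mult_le[of a d] degree_mult_le[of c b]
    by (intro degree_add_le) auto
  ultimately have "rat_eval (Fraction_Field.Fract (a * d + c * b) (b * d)) s =
      poly_at s (degree b + degree d) (a * d + c * b) / poly_at s (degree b + degree d) (b * d)"
    using rat_eval_Fract[OF s stable_poly_mult[OF *(1,4)], of "a * d + c * b"] by simp
  also have "poly_at s (degree b + degree d) (a * d + c * b) =
      poly_at s (degree b) a * poly_at s (degree d) d + poly_at s (degree d) c * poly_at s (degree b) b"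
    using * by (simp add: poly_at_add poly_at_mult poly_at_mult[of c "degree d" b "degree b", simplified add.commute])
  finally show ?thesis
    using * rat_eval_Fract[OF s, of b a] rat_eval_Fract[OF s, of d c] \<open>b \<noteq> 0\<close> \<open>d \<noteq> 0\<close>
      poly_at_stable[OF s, of b] poly_at_stable[OF s, of d]
    by (simp add: poly_at_mult add_frac_eq mult.commute)
qed

lemma rat_eval_uminus:
  assumes "x \<in> HH" shows "rat_eval (- x) s = - rat_eval x s"
  using rat_eval_add[OF assms HH_uminus[OF assms]] by (simp add: rat_eval_0 add_eq_0_iff)

lemma rat_eval_sum:
  "(\<And>i. i \<in> I \<Longrightarrow> f i \<in> HH) \<Longrightarrow> rat_eval (sum f I) s = (\<Sum>i\<in>I. rat_eval (f i) s)"
  by (induction I rule: infinite_finite_induct) (auto simp: rat_eval_0 rat_eval_add HH_sum)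

lemma rat_eval_prod:
  "(\<And>i. i \<in> I \<Longrightarrow> f i \<in> HH) \<Longrightarrow> rat_eval (prod f I) s = (\<Prod>i\<in>I. rat_eval (f i) s)"
  by (induction I rule: infinite_finite_induct) (auto simp: rat_eval_1 rat_eval_mult HH_prod)

lemma rat_eval_power: "x \<in> HH \<Longrightarrow> rat_eval (x ^ n) s = rat_eval x s ^ n"
  by (induction n) (auto simp: rat_eval_1 rat_eval_mult HH_power)

text \<open>Rectangular shapes are allowed, since the block row \<open>[\<Delta>0 \<Delta>1]\<close>
  is \<open>m\<close> by \<open>2 * m\<close>; hence the entrywise condition instead of
  \<open>HH_mat\<close>.\<close>

lemma eval_mat_mult:
  assumes A: "A \<in> carrier_mat nr n" and B: "B \<in> carrier_mat n nc"
    and H: "elements_mat A \<subseteq> HH" "elements_mat B \<subseteq> HH"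
  shows "eval_mat (A * B) s = eval_mat A s * eval_mat B s"
proof (rule eq_matI)
  fix i j assume "i < dim_row (eval_mat A s * eval_mat B s)" "j < dim_col (eval_mat A s * eval_mat B s)"
  then have ij: "i < nr" "j < nc" using A B by auto
  have H': "A $$ (i, k) \<in> HH" "B $$ (k, j) \<in> HH" if "k < n" for k
    using H A B ij that by blast+
  show "eval_mat (A * B) s $$ (i, j) = (eval_mat A s * eval_mat B s) $$ (i, j)"
    using A B ij H'
    by (simp add: scalar_prod_def, subst rat_eval_sum) (auto simp: HH_mult rat_eval_mult)
qed (use A B in auto)

text \<open>The Leibniz formula uses ring operations only, and evaluation respects them.\<close>

lemma det_eval_mat:
  assumes "A \<in> HH_mat m" shows "det (eval_mat A s) = rat_eval (det A) s"
proof -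
  have A: "A \<in> carrier_mat m m" and H: "\<And>i j. i < m \<Longrightarrow> j < m \<Longrightarrow> A $$ (i, j) \<in> HH"
    using assms by (auto simp: HH_mat_iff)
  have sg: "signof p \<in> HH" "rat_eval (signof p) s = signof p" for p :: "nat \<Rightarrow> nat"
    by (auto simp: sign_def HH_1 HH_uminus rat_eval_uminus rat_eval_1)
  have p: "(\<Prod>i = 0..<m. A $$ (i, p i)) \<in> HH"
    "rat_eval (\<Prod>i = 0..<m. A $$ (i, p i)) s = (\<Prod>i = 0..<m. eval_mat A s $$ (i, p i))"
    if "p permutes {0..<m}" for p
  proof -
    have "A $$ (i, p i) \<in> HH" "p i < m" if "i < m" for i
      using permutes_in_image[OF \<open>p permutes _\<close>, of i] that H by auto
    then show "(\<Prod>i = 0..<m. A $$ (i, p i)) \<in> HH"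
      "rat_eval (\<Prod>i = 0..<m. A $$ (i, p i)) s = (\<Prod>i = 0..<m. eval_mat A s $$ (i, p i))"
      using A by (auto intro!: HH_prod, subst rat_eval_prod) auto
  qed
  have E: "eval_mat A s \<in> carrier_mat m m" using A by simp
  show ?thesis
    unfolding det_def'[OF A] det_def'[OF E]
    by (subst rat_eval_sum) (auto simp: HH_mult sg p rat_eval_mult)
qed

lemma adj_mat_eval_mat:
  assumes "A \<in> HH_mat m" shows "adj_mat (eval_mat A s) = eval_mat (adj_mat A) s"
proof (rule eq_matI)
  have A: "A \<in> carrier_mat m m" using assms by (simp add: HH_mat_def)
  fix i j assume "i < dim_row (eval_mat (adj_mat A) s)" "j < dim_col (eval_mat (adj_mat A) s)"
  then have ij: "i < m" "j < m" using A adj_mat(1)[OF A] by auto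
  have D: "mat_delete A j i \<in> HH_mat (m - 1)"
    using assms by (auto simp: HH_mat_iff mat_delete_def)
  have "mat_delete (eval_mat A s) j i = eval_mat (mat_delete A j i) s"
    using A ij by (intro eq_matI) (auto simp: mat_delete_def)
  then show "adj_mat (eval_mat A s) $$ (i, j) = eval_mat (adj_mat A) s $$ (i, j)"
    using A ij D by (simp add: adj_mat_def cofactor_def det_eval_mat det_HH rat_eval_mult HH_power
        HH_uminus HH_1 rat_eval_power rat_eval_uminus rat_eval_1)
qed (use assms adj_mat(1)[of A m] adj_mat(1)[of "eval_mat A s" m] in \<open>auto simp: HH_mat_def\<close>)

end


section \<open>Divisibility and units in \<open>HH\<close>\<close>

text \<open>A Bezout identity over the reals persists over the complex numbers, so real coprimeness
  also excludes common nonreal roots.\<close>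

lemma coprime_of_real_no_common_root:
  fixes p q :: "real poly"
  assumes "coprime p q" "poly (map_poly complex_of_real p) z = 0"
  shows "poly (map_poly complex_of_real q) z \<noteq> 0"
proof
  assume q: "poly (map_poly complex_of_real q) z = 0"
  from assms(1) obtain u v where "u * p + v * q = 1"
    using bezout_coefficients_fst_snd[of p q] by (metis coprime_imp_gcd_eq_1)
  then have "map_poly complex_of_real (u * p + v * q) = 1" by simp
  then have "poly (map_poly complex_of_real (u * p + v * q)) z = 1" by simp
  then show False using assms(2) q by (simp add: map_of_real_add map_of_real_mult)
qed

text \<open>With \<open>x = a / b\<close>, \<open>d = n / e\<close> and \<open>x / d = p / q\<close> in lowest terms, \<open>p n b = a q e\<close>:
  comparing degrees gives properness, and at an unstable root of \<open>q\<close> the orders of \<open>a\<close> and \<open>q\<close>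
  would add up to more than the order of \<open>n\<close>.\<close>

lemma
  assumes x: "x \<in> HH" and d: "d \<in> HH" "rat_eval d Infinity \<noteq> 0"
  shows HH_divide_proper: "proper (x / d)"
    and HH_divide: "(\<And>z. \<lbrakk>Re z \<ge> 0; rat_eval d (Fin z) = 0\<rbrakk> \<Longrightarrow>
       order z (numer d) = 1 \<and> rat_eval x (Fin z) = 0) \<Longrightarrow> x / d \<in> HH"
proof -
  have "proper (x / d) \<and> ((\<forall>z. Re z \<ge> 0 \<longrightarrow> rat_eval d (Fin z) = 0 \<longrightarrow>
       order z (numer d) = 1 \<and> rat_eval x (Fin z) = 0) \<longrightarrow> x / d \<in> HH)"
  \<comment> \<open>Degrees and root orders add up only for nonzero factors, so \<open>x = 0\<close>
    is split off.\<close>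
  proof (cases "x = 0")
    case False
    let ?c = "map_poly complex_of_real"
    define a b n e p q where "a = fst (quot_of_fract x)" and "b = snd (quot_of_fract x)"
      and "n = fst (quot_of_fract d)" and "e = snd (quot_of_fract d)"
      and "p = fst (quot_of_fract (x / d))" and "q = snd (quot_of_fract (x / d))"
    note defs = this
    have nz: "b \<noteq> 0" "e \<noteq> 0" "q \<noteq> 0" by (simp_all add: defs)
    have eqs: "Fraction_Field.Fract a b = x" "Fraction_Field.Fract n e = d"
      "Fraction_Field.Fract p q = x / d" by (simp_all add: defs)
    have d0: "d \<noteq> 0" using d(2) by (auto simp: rat_eval_0)
    then have "n \<noteq> 0" "a \<noteq> 0" using eqs nz False by (auto simp: Zero_fract_def eq_fract)
    have "Fraction_Field.Fract a b = Fraction_Field.Fract p q * Fraction_Field.Fract n e"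
      unfolding eqs using d0 by simp
    then have eq: "p * n * b = a * q * e" using nz by (simp add: eq_fract mult_ac)
    then have "p \<noteq> 0" using nz \<open>a \<noteq> 0\<close> by auto
    have st: "stable_poly b" "stable_poly e" and deg: "degree a \<le> degree b" "degree n \<le> degree e"
      using HH_quot_of_fract[OF x] HH_quot_of_fract[OF d(1)] by (simp_all add: defs)
    \<comment> \<open>A nonzero value at infinity means relative degree zero, so division by
      \<open>d\<close> does not raise the relative degree of the numerator over the
      denominator.\<close>
    have "coeff n (degree e) \<noteq> 0" using d(2) nz
      by (simp add: rat_eval_poly_at poly_at_def defs)
    then have dn: "degree n = degree e" using deg(2) le_degree by fastforce
    have "degree p + degree n + degree b = degree a + degree q + degree e"
      using arg_cong[OF eq, of degree] nz \<open>n \<noteq> 0\<close> \<open>a \<noteq> 0\<close> \<open>p \<noteq> 0\<close> by (simp add: degree_mult_eq)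
    then have pr: "degree p \<le> degree q" using dn deg by linarith
    have "Re z < 0"
      if qz: "poly (?c q) z = 0" and ze: "\<forall>z. Re z \<ge> 0 \<longrightarrow> rat_eval d (Fin z) = 0 \<longrightarrow>
         order z (numer d) = 1 \<and> rat_eval x (Fin z) = 0" for z
    proof (rule ccontr)
      assume z: "\<not> Re z < 0"
      have cnz: "?c p \<noteq> 0" "?c n \<noteq> 0" "?c b \<noteq> 0" "?c a \<noteq> 0" "?c q \<noteq> 0" "?c e \<noteq> 0"
        using nz \<open>n \<noteq> 0\<close> \<open>a \<noteq> 0\<close> \<open>p \<noteq> 0\<close> by (auto simp: map_poly_eq_0_iff)
      have bez: "poly (?c b) z \<noteq> 0" "poly (?c e) z \<noteq> 0"
        using st z by (auto simp: stable_poly_def)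
      have "coprime q p" using coprime_quot_of_fract[of "x / d"]
        by (simp add: defs coprime_commute)
      then have pz: "poly (?c p) z \<noteq> 0" using qz by (rule coprime_of_real_no_common_root)
      have "?c p * ?c n * ?c b = ?c a * ?c q * ?c e"
        using arg_cong[OF eq, of ?c] by (simp add: map_of_real_mult)
      from arg_cong[OF this, of "order z"]
      have ord: "order z (?c n) = order z (?c a) + order z (?c q)"
        using cnz bez pz by (simp add: order_mult order_0I)
      have oq: "order z (?c q) \<noteq> 0" using qz cnz by (simp add: order_root)
      then have "poly (?c n) z = 0" using ord by (simp add: order_root)
      then have "rat_eval d (Fin z) = 0" by (simp add: rat_eval.simps numer_def defs)
      with ze z have o1: "order z (?c n) = 1" and "rat_eval x (Fin z) = 0"
        by (auto simp: numer_def defs)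
      then have "poly (?c a) z = 0" using bez by (simp add: rat_eval.simps numer_def denom_def defs)
      then have "order z (?c a) \<noteq> 0" using cnz by (simp add: order_root)
      then show False using ord o1 oq by simp
    qed
    moreover have "x / d \<in> HH" if "stable_poly q"
      using that pr eqs(3) unfolding HH_iff_stable by metis
    moreover have "proper (x / d)"
      using pr by (simp add: proper_def numer_def denom_def degree_map_poly p_def q_def)
    ultimately show ?thesis using nz by (auto simp: stable_poly_def)
  qed (use HH_0 in \<open>auto simp: HH_def\<close>)
  then show "proper (x / d)" and "(\<And>z. \<lbrakk>Re z \<ge> 0; rat_eval d (Fin z) = 0\<rbrakk> \<Longrightarrow>
       order z (numer d) = 1 \<and> rat_eval x (Fin z) = 0) \<Longrightarrow> x / d \<in> HH"
    by blast+
qed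

text \<open>The inverse is \<open>1 / u\<close>. In \<open>HH_divide\<close> the condition at
  unstable zeros is vacuous, and the value at \<open>Infinity\<close> is nonzero by
  assumption.\<close>

lemma JJ_if_no_zeros:
  assumes u: "u \<in> HH" and nz: "\<And>s. s \<in> C_plus \<Longrightarrow> rat_eval u s \<noteq> 0"
  shows "u \<in> JJ"
proof -
  have "1 / u \<in> HH"
    using nz by (intro HH_divide HH_1 u) (auto simp: C_plus_def C_minus_def)
  moreover have "u \<noteq> 0" using nz[of Infinity] by (auto simp: rat_eval_0 C_plus_def)
  ultimately show ?thesis unfolding JJ_def using u by (auto intro!: bexI[of _ "1 / u"])
qed

section \<open>Bounds on the half plane and small perturbations\<close>

text \<open>Induction on the degree of \<open>q\<close>, splitting off one linear factor by
  \<open>p / ((z - r) q') = p(r) / ((z - r) q') + p' / q'\<close>.\<close>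

lemma quotient_bounded:
  fixes p q :: "complex poly"
  assumes "\<And>z. poly q z = 0 \<Longrightarrow> Re z < 0" "degree p \<le> degree q"
  shows "\<exists>B. \<forall>z. Re z \<ge> 0 \<longrightarrow> norm (poly p z / poly q z) \<le> B"
  using assms
proof (induction "degree q" arbitrary: p q)
  case 0
  then obtain a b where "p = [:a:]" "q = [:b:]" by (metis degree_eq_zeroE le_zero_eq)
  then show ?case by auto
next
  case (Suc k)
  have "\<not> constant (poly q)" using Suc.hyps(2) by (simp add: constant_degree)
  then obtain r where r: "poly q r = 0" using fundamental_theorem_of_algebra by blast
  then have Rr: "Re r < 0" using Suc.prems by blast
  from r obtain q' where q': "q = [:- r, 1:] * q'" by (auto simp: poly_eq_0_iff_dvd)
  have "[:- r, 1:] dvd p - [:poly p r:]" by (simp add: poly_eq_0_iff_dvd[symmetric])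
  then obtain p' where p': "p = [:poly p r:] + [:- r, 1:] * p'"
    by (metis add.commute diff_add_cancel dvd_def)
  have "q' \<noteq> 0" using Suc.hyps(2) q' by auto
  then have "degree q = Suc (degree q')" unfolding q' by (subst degree_mult_eq) auto
  then have dq: "degree q' = k" using Suc.hyps(2) by simp
  have dp: "degree p' \<le> k"
  proof (cases "p' = 0")
    case False
    have "degree ([:- r, 1:] * p') = Suc (degree p')" using False
      by (subst degree_mult_eq) auto
    moreover have "degree ([:- r, 1:] * p') = degree p"
      \<comment> \<open>Adding a constant does not change a positive degree.\<close>
      using p' \<open>degree ([:- r, 1:] * p') = Suc (degree p')\<close>
      by (metis degree_add_eq_right degree_pCons_0 zero_less_Suc)
    ultimately show ?thesis using Suc.prems(2) Suc.hyps(2) by simp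
  qed simp
  have st: "\<And>z. poly q' z = 0 \<Longrightarrow> Re z < 0" using Suc.prems(1) by (simp add: q')
  obtain B1 where B1: "\<And>z. Re z \<ge> 0 \<Longrightarrow> norm (poly p' z / poly q' z) \<le> B1"
    using Suc.hyps(1)[of q' p'] dq dp st by blast
  obtain B2 where B2: "\<And>z. Re z \<ge> 0 \<Longrightarrow> norm (poly [:poly p r:] z / poly q' z) \<le> B2"
    using Suc.hyps(1)[of q' "[:poly p r:]"] dq st by auto
  have "norm (poly p z / poly q z) \<le> B2 / - Re r + B1" if z: "Re z \<ge> 0" for z
  proof -
    \<comment> \<open>The root \<open>r\<close> has distance at least \<open>- Re r > 0\<close> from
      the closed right half plane, which bounds the reciprocal of the linear factor.\<close>
    have zr: "norm (z - r) \<ge> - Re r" using complex_Re_le_cmod[of "z - r"] z by simp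
    then have "z \<noteq> r" using Rr by auto
    have "poly p z = poly p r + (z - r) * poly p' z"
      by (subst p') (simp add: algebra_simps)
    moreover have "poly q z = (z - r) * poly q' z" by (simp add: q' algebra_simps)
    moreover have "poly q' z \<noteq> 0" using st[of z] z by auto
    ultimately have "poly p z / poly q z = (poly p r / poly q' z) / (z - r) + poly p' z / poly q' z"
      using \<open>z \<noteq> r\<close> by (simp add: add_divide_distrib mult.commute)
    then have "norm (poly p z / poly q z) \<le>
        norm (poly p r / poly q' z) / norm (z - r) + norm (poly p' z / poly q' z)"
      by (metis norm_divide norm_triangle_ineq)
    also have "\<dots> \<le> B2 / - Re r + B1"
      using B1[OF z] B2[OF z] zr Rr by (intro add_mono frac_le) (auto intro: order_trans[OF norm_ge_zero])
    finally show ?thesis .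
  qed
  then show ?case by blast
qed

lemma HH_bounded:
  assumes "h \<in> HH" shows "\<exists>B. \<forall>s \<in> C_plus. norm (rat_eval h s) \<le> B"
proof -
  obtain B where "\<forall>z. Re z \<ge> 0 \<longrightarrow> norm (poly (numer h) z / poly (denom h) z) \<le> B"
    using quotient_bounded[of "denom h" "numer h"] assms
    by (auto simp: HH_def proper_def finite_poles_def C_minus_def)
  then show ?thesis
    by (intro exI[of _ "max B (norm (rat_eval h Infinity))"])
      (auto simp: C_plus_def C_minus_def rat_eval.simps(1) intro: max.coboundedI1)
qed

text \<open>A kernel vector is compared with its entry of largest modulus.\<close>

lemma det_one_add_small:
  fixes G :: "complex mat"
  assumes G: "G \<in> carrier_mat m m" and B: "\<And>i j. i < m \<Longrightarrow> j < m \<Longrightarrow> norm (G $$ (i, j)) \<le> B"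
    and small: "real m * B < 1"
  shows "det (1\<^sub>m m + G) \<noteq> 0"
proof
  assume "det (1\<^sub>m m + G) = 0"
  then obtain v where v: "v \<in> carrier_vec m" "v \<noteq> 0\<^sub>v m" "(1\<^sub>m m + G) *\<^sub>v v = 0\<^sub>v m"
    using G det_0_iff_vec_prod_zero[of "1\<^sub>m m + G" m] by auto
  \<comment> \<open>The maximum below must range over a nonempty set.\<close>
  have m0: "m > 0" using v by (cases m) auto
  define N where "N = Max ((\<lambda>i. norm (v $ i)) ` {..<m})"
  have N: "norm (v $ i) \<le> N" if "i < m" for i using that by (simp add: N_def)
  have "N \<in> (\<lambda>i. norm (v $ i)) ` {..<m}" unfolding N_def using m0 by (intro Max_in) auto
  then obtain k where k: "k < m" "N = norm (v $ k)" by auto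
  have "v + G *\<^sub>v v = 0\<^sub>v m" using v G by (simp add: add_mult_distrib_mat_vec[of _ m m])
  then have "(v + G *\<^sub>v v) $ k = 0" using k by simp
  then have "v $ k = - (\<Sum>j = 0..<m. G $$ (k, j) * v $ j)"
    using k v G by (simp add: scalar_prod_def eq_neg_iff_add_eq_0)
  then have "N \<le> (\<Sum>j = 0..<m. norm (G $$ (k, j) * v $ j))"
    using k by (simp add: norm_sum)
  also have "\<dots> \<le> (\<Sum>j = 0..<m. B * N)"
    using B k N by (intro sum_mono) (auto simp: norm_mult intro!: mult_mono order_trans[OF norm_ge_zero])
  \<comment> \<open>The second factor is positive, so the largest modulus is at most zero and the
    kernel vector vanishes.\<close>
  finally have "N * (1 - real m * B) \<le> 0" by (simp add: algebra_simps)
  then have "N \<le> 0" using small by (simp add: mult_le_0_iff)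
  then have "v $ i = 0" if "i < m" for i using N[OF that] norm_ge_zero[of "v $ i"]
    by (meson norm_le_zero_iff order_trans)
  then show False using v by (auto intro!: eq_vecI)
qed


lemma HH_mat_bounded:
  assumes "G \<in> HH_mat m"
  obtains B where "B \<ge> 0"
    "\<And>s i j. s \<in> C_plus \<Longrightarrow> i < m \<Longrightarrow> j < m \<Longrightarrow> norm (rat_eval (G $$ (i, j)) s) \<le> B"
proof -
  have "\<forall>i j. \<exists>B. i < m \<longrightarrow> j < m \<longrightarrow> (\<forall>s \<in> C_plus. norm (rat_eval (G $$ (i, j)) s) \<le> B)"
    using assms HH_bounded by (meson HH_mat_iff)
  then obtain b where b: "\<And>s i j. s \<in> C_plus \<Longrightarrow> i < m \<Longrightarrow> j < m \<Longrightarrow>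
      norm (rat_eval (G $$ (i, j)) s) \<le> b i j" by metis
  \<comment> \<open>A sum of absolute values dominates every entry bound, is nonnegative, and also
    makes sense for \<open>m = 0\<close>, where a maximum would not.\<close>
  define B where "B = (\<Sum>p \<in> {..<m} \<times> {..<m}. \<bar>b (fst p) (snd p)\<bar>)"
  have "b i j \<le> B" if "i < m" "j < m" for i j
    using member_le_sum[of "(i, j)" "{..<m} \<times> {..<m}" "\<lambda>p. \<bar>b (fst p) (snd p)\<bar>"] that
    by (auto simp: B_def)
  then have "norm (rat_eval (G $$ (i, j)) s) \<le> B" if "s \<in> C_plus" "i < m" "j < m" for s i j
    using b[OF that] that by (meson order_trans)
  moreover have "B \<ge> 0" by (simp add: B_def sum_nonneg)
  ultimately show ?thesis using that by blast
qed

text \<open>Factor the perturbed matrix as \<open>U * (1 + \<epsilon> G)\<close> with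
  \<open>G\<close> the product of the inverse of \<open>U\<close> and \<open>D\<close>. As
  \<open>G\<close> is over the ring, it is bounded uniformly on \<open>C_plus\<close>; for small
  \<open>\<epsilon>\<close> the determinant of the second factor has no zero there and is a
  unit.\<close>

lemma unimodular_perturb:
  assumes U: "unimodular m U" and D: "D \<in> HH_mat m"
  obtains \<delta> where "\<delta> > 0"
    "\<And>\<epsilon>. 0 < \<epsilon> \<Longrightarrow> \<epsilon> < \<delta> \<Longrightarrow> unimodular m (U + to_fract [:\<epsilon>:] \<cdot>\<^sub>m D)"
proof -
  obtain V where V: "V \<in> HH_mat m" "U * V = 1\<^sub>m m"
    using unimodular_inverse[OF U] by metis
  define G where "G = V * D"
  have G: "G \<in> HH_mat m" unfolding G_def using V D by (simp add: HH_mat_mult)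
  have C: "U \<in> carrier_mat m m" "V \<in> carrier_mat m m" "D \<in> carrier_mat m m" "G \<in> carrier_mat m m"
    using U V D G by (auto simp: unimodular_def HH_mat_def)
  obtain B where B: "B \<ge> 0"
    "\<And>s i j. s \<in> C_plus \<Longrightarrow> i < m \<Longrightarrow> j < m \<Longrightarrow> norm (rat_eval (G $$ (i, j)) s) \<le> B"
    using HH_mat_bounded[OF G] by blast
  have mB: "real m * B + 1 > 0" using B by (intro add_nonneg_pos) auto
  \<comment> \<open>The summand 1 keeps the threshold positive and finite even if
    \<open>real m * B\<close> is zero.\<close>
  have "unimodular m (U + to_fract [:\<epsilon>:] \<cdot>\<^sub>m D)" if \<epsilon>: "0 < \<epsilon>" "\<epsilon> < 1 / (real m * B + 1)" for \<epsilon>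
  proof -
    let ?e = "to_fract [:\<epsilon>:]"
    have eG: "?e \<cdot>\<^sub>m G \<in> HH_mat m" using G by (auto simp: HH_mat_iff HH_mult HH_const)
    then have H: "1\<^sub>m m + ?e \<cdot>\<^sub>m G \<in> HH_mat m"
      by (intro HH_mat_add) (auto simp: HH_mat_iff HH_0 HH_1)
    have "rat_eval (det (1\<^sub>m m + ?e \<cdot>\<^sub>m G)) s \<noteq> 0" if s: "s \<in> C_plus" for s
    proof -
      have "eval_mat (1\<^sub>m m + ?e \<cdot>\<^sub>m G) s = 1\<^sub>m m + eval_mat (?e \<cdot>\<^sub>m G) s"
        using G by (intro eq_matI) (auto simp: HH_mat_iff rat_eval_add[OF s] HH_0 HH_1 HH_mult HH_const
            rat_eval_0 rat_eval_1)
      moreover have "det (1\<^sub>m m + eval_mat (?e \<cdot>\<^sub>m G) s) \<noteq> 0"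
      proof (rule det_one_add_small[where B = "\<epsilon> * B"])
        show "norm (eval_mat (?e \<cdot>\<^sub>m G) s $$ (i, j)) \<le> \<epsilon> * B" if "i < m" "j < m" for i j
          using B(2)[OF s that] \<epsilon> G that
          by (auto simp: HH_mat_iff rat_eval_mult[OF s] HH_const rat_eval_const[OF s] norm_mult)
        have "\<epsilon> * (real m * B + 1) < 1" using \<epsilon> mB by (simp add: pos_less_divide_eq)
        then show "real m * (\<epsilon> * B) < 1" using \<epsilon> by (simp add: algebra_simps)
      qed (use C in simp)
      ultimately show ?thesis using det_eval_mat[OF s H] by simp
    qed
    then have "unimodular m (1\<^sub>m m + ?e \<cdot>\<^sub>m G)"
      unfolding unimodular_def using H by (auto intro: JJ_if_no_zeros det_HH)
    then have "unimodular m (U * (1\<^sub>m m + ?e \<cdot>\<^sub>m G))" using U by (rule unimodular_mult[rotated])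
    moreover have "U * (1\<^sub>m m + ?e \<cdot>\<^sub>m G) = U + ?e \<cdot>\<^sub>m (U * G)"
      using C by (simp add: mult_add_distrib_mat[of _ m m _ m] mult_smult_distrib[of _ m m _ m])
    moreover have "U * G = D"
      using assoc_mult_mat[OF C(1-3)] V(2) C(3) by (simp add: G_def)
    ultimately show ?thesis by simp
  qed
  then show ?thesis using that[of "1 / (real m * B + 1)"] mB by simp
qed

text \<open>The shifted matrix is singular exactly when \<open>- \<epsilon>\<close> is an eigenvalue
  of \<open>A\<close>, and the characteristic polynomial is monic, hence has finitely many
  roots.\<close>

lemma finite_singular_shifts:
  fixes A :: "complex mat"
  assumes A: "A \<in> carrier_mat m m"
  shows "finite {\<epsilon>. det (A + complex_of_real \<epsilon> \<cdot>\<^sub>m 1\<^sub>m m) = 0}"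
proof -
  have "{\<epsilon>. det (A + complex_of_real \<epsilon> \<cdot>\<^sub>m 1\<^sub>m m) = 0} =
      (\<lambda>\<epsilon>. - complex_of_real \<epsilon>) -` {k. poly (char_poly A) k = 0}"
    using A by (auto simp: char_matrix_def eigenvalue_det[OF A] simp flip: eigenvalue_root_char_poly)
  moreover have "char_poly A \<noteq> 0" using degree_monic_char_poly[OF A] by auto
  then have "finite ((\<lambda>\<epsilon>. - complex_of_real \<epsilon>) -` {k. poly (char_poly A) k = 0})"
    by (intro finite_vimageI poly_roots_finite injI) auto
  ultimately show ?thesis by simp
qed

section \<open>Block rows\<close>

lemma append_cols_carrier:
  "A \<in> carrier_mat nr nc1 \<Longrightarrow> B \<in> carrier_mat nr nc2 \<Longrightarrow>
    append_cols A B \<in> carrier_mat nr (nc1 + nc2)"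
  by (auto simp: append_cols_def)

lemma append_cols_index:
  "A \<in> carrier_mat nr nc1 \<Longrightarrow> B \<in> carrier_mat nr nc2 \<Longrightarrow> i < nr \<Longrightarrow> j < nc1 + nc2 \<Longrightarrow>
    append_cols A B $$ (i, j) = (if j < nc1 then A $$ (i, j) else B $$ (i, j - nc1))"
  by (auto simp: append_cols_def)

lemma append_cols_inject:
  assumes "A \<in> carrier_mat nr nc1" "B \<in> carrier_mat nr nc2"
    "A' \<in> carrier_mat nr nc1" "B' \<in> carrier_mat nr nc2" "append_cols A B = append_cols A' B'"
  shows "A = A'" "B = B'"
proof -
  have *: "append_cols A B $$ (i, j) = append_cols A' B' $$ (i, j)" for i j using assms(5) by simp
  have "A $$ (i, j) = A' $$ (i, j)" if "i < nr" "j < nc1" for i j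
    using *[of i j] that by (simp add: append_cols_index[OF assms(1,2)] append_cols_index[OF assms(3,4)])
  then show "A = A'" using assms by (intro eq_matI) auto
  have "B $$ (i, j) = B' $$ (i, j)" if "i < nr" "j < nc2" for i j
    using *[of i "nc1 + j"] that
    by (simp add: append_cols_index[OF assms(1,2)] append_cols_index[OF assms(3,4)])
  then show "B = B'" using assms by (intro eq_matI) auto
qed

lemma append_cols_mult:
  assumes "A \<in> carrier_mat nr n1" "B \<in> carrier_mat nr n2"
    "N0 \<in> carrier_mat n1 nc1" "N1 \<in> carrier_mat n1 nc2"
    "D0 \<in> carrier_mat n2 nc1" "D1 \<in> carrier_mat n2 nc2"
  shows "append_cols A B * four_block_mat N0 N1 D0 D1 =
    append_cols (A * N0 + B * D0) (A * N1 + B * D1)"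
proof -
  \<comment> \<open>A block row is a block matrix with lower blocks of height zero, so block
    multiplication applies.\<close>
  have z: "0\<^sub>m 0 (dim_col A) \<in> carrier_mat 0 n1" "0\<^sub>m 0 (dim_col B) \<in> carrier_mat 0 n2"
    using assms by auto
  show ?thesis unfolding append_cols_def mult_four_block_mat[OF assms(1,2) z assms(3-6)]
    by (rule cong_four_block_mat) (use assms in auto)
qed

lemma eval_mat_append_cols:
  "A \<in> carrier_mat nr nc1 \<Longrightarrow> B \<in> carrier_mat nr nc2 \<Longrightarrow>
    eval_mat (append_cols A B) s = append_cols (eval_mat A s) (eval_mat B s)"
  by (intro eq_matI) (auto simp: append_cols_def)

section \<open>Coprimeness and properness of the compensator\<close>

text \<open>A common left divisor \<open>L\<close> factors out of the combination, so
  \<open>det L\<close> divides a unit of the ring.\<close>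

lemma left_coprime_if_unimodular_combination:
  assumes H: "N \<in> HH_mat m" "D \<in> HH_mat m" and u: "unimodular m (Nc * N + Dc * D)"
  shows "left_coprime m Nc Dc"
  unfolding left_coprime_def
proof (intro ballI impI)
  fix A B L assume ABL: "A \<in> HH_mat m" "B \<in> HH_mat m" "L \<in> HH_mat m"
    and eq: "Nc = L * A \<and> Dc = L * B"
  let ?Q = "A * N + B * D"
  have Q: "?Q \<in> HH_mat m" using ABL H by (simp add: HH_mat_add HH_mat_mult)
  have C: "A \<in> carrier_mat m m" "B \<in> carrier_mat m m" "L \<in> carrier_mat m m"
    "N \<in> carrier_mat m m" "D \<in> carrier_mat m m" "?Q \<in> carrier_mat m m"
    using ABL H Q by (auto simp: HH_mat_def)
  have "Nc * N + Dc * D = L * ?Q"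
    using C eq by (simp add: mult_add_distrib_mat[of _ m m _ m] assoc_mult_mat[of _ m m _ m _ m])
  then have "det L * det ?Q \<in> JJ" using u C by (simp add: unimodular_def det_mult)
  then obtain v where "v \<in> HH" "det L * det ?Q * v = 1" by (auto simp: JJ_def)
  then have "det L \<in> JJ" unfolding JJ_def using det_HH[OF ABL(3)] det_HH[OF Q]
    by (auto intro!: bexI[of _ "det ?Q * v"] HH_mult simp: mult.assoc)
  then show "unimodular m L" using ABL by (simp add: unimodular_def)
qed

text \<open>By Cramer's rule the entries of \<open>K\<close> are ring elements divided by
  \<open>det Dc\<close>. Such quotients are proper because \<open>det Dc\<close> does not vanish at
  infinity; its finite unstable zeros may remain as poles of \<open>K\<close>.\<close>

lemma proper_compensator:
  assumes H: "Nc \<in> HH_mat m" "Dc \<in> HH_mat m" and cop: "left_coprime m Nc Dc"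
    and inf: "rat_eval (det Dc) Infinity \<noteq> 0"
  obtains K where "left_coprime_factorization m K Nc Dc" "proper_mat K"
proof -
  define d where "d = det Dc"
  define K where "K = ((1 / d) \<cdot>\<^sub>m adj_mat Dc) * Nc"
  have d: "d \<noteq> 0" "d \<in> HH" using inf det_HH[OF H(2)] by (auto simp: d_def rat_eval_0)
  have C: "Nc \<in> carrier_mat m m" "Dc \<in> carrier_mat m m" "adj_mat Dc \<in> carrier_mat m m"
    using H adj_mat(1) by (auto simp: HH_mat_def)
  have one: "(1 / d) \<cdot>\<^sub>m (d \<cdot>\<^sub>m 1\<^sub>m m) = 1\<^sub>m m" using d by (intro eq_matI) auto
  have "inverts_mat Dc ((1 / d) \<cdot>\<^sub>m adj_mat Dc)" "inverts_mat ((1 / d) \<cdot>\<^sub>m adj_mat Dc) Dc"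
    using adj_mat(2,3)[OF C(2)] one C
    by (simp_all add: inverts_mat_def d_def mult_smult_distrib[of _ m m _ m] mult_smult_assoc_mat[of _ m m _ m])
  then have "left_coprime_factorization m K Nc Dc"
    unfolding left_coprime_factorization_def
    using H cop C by (intro conjI bexI[of _ "(1 / d) \<cdot>\<^sub>m adj_mat Dc"]) (simp_all add: K_def)
  moreover have "proper_mat K"
  proof -
    have "K = (1 / d) \<cdot>\<^sub>m (adj_mat Dc * Nc)"
      unfolding K_def using C by (simp add: mult_smult_assoc_mat[of _ m m _ m])
    then have "elements_mat K = (\<lambda>x. x / d) ` elements_mat (adj_mat Dc * Nc)"
      by (simp add: smult_mat_def)
    moreover have "adj_mat Dc * Nc \<in> HH_mat m" using H by (intro HH_mat_mult adj_mat_HH)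
    ultimately show ?thesis unfolding proper_mat_def HH_mat_def
      using HH_divide_proper[OF _ d(2)] inf by (auto simp: d_def)
  qed
  ultimately show ?thesis using that by blast
qed

section \<open>Simultaneous stabilization as interpolation\<close>

theorem proposition4:
  fixes m :: nat and P0 P1 N0 D0 N1 D1 M :: "ratfun mat"
  assumes "right_coprime_factorization m P0 N0 D0"
    and "right_coprime_factorization m P1 N1 D1"
    and "P0 \<noteq> P1"
    and "M = four_block_mat N0 N1 D0 D1"
    and "rat_eval (det M) Infinity \<noteq> 0"
    and "\<forall>s \<in> zeros_in_C_plus (det M). zero_multiplicity (det M) s = 1"
  shows "(\<exists>K. compensator m K \<and> proper_mat K \<and> simultaneously_stabilizes m K P0 P1) \<longleftrightarrow>
    (\<exists>\<Delta>0 \<Delta>1. unimodular m \<Delta>0 \<and> unimodular m \<Delta>1 \<and>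
       (\<forall>s \<in> zeros_in_C_plus (det M).
          append_cols (eval_mat \<Delta>0 s) (eval_mat \<Delta>1 s) * adj_mat (eval_mat M s) = 0\<^sub>m m (2 * m)))"
proof -
  let ?d = "det M"
  have H: "N0 \<in> HH_mat m" "D0 \<in> HH_mat m" "N1 \<in> HH_mat m" "D1 \<in> HH_mat m"
    using assms(1,2) by (auto simp: right_coprime_factorization_def)
  then have C: "N0 \<in> carrier_mat m m" "D0 \<in> carrier_mat m m" "N1 \<in> carrier_mat m m"
    "D1 \<in> carrier_mat m m" by (auto simp: HH_mat_def)
  have M: "M \<in> carrier_mat (2 * m) (2 * m)"
    unfolding assms(4) mult_2 using C by simp
  have MH: "M \<in> HH_mat (2 * m)"
    using M elements_four_block_mat[of N0 m m N1 m D0 m D1] H unfolding HH_mat_def assms(4) by auto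
  have adj: "adj_mat M \<in> HH_mat (2 * m)" "adj_mat M \<in> carrier_mat (2 * m) (2 * m)"
    using adj_mat_HH[OF MH] by (auto simp: HH_mat_def)
  have app_HH: "elements_mat (append_cols A B) \<subseteq> HH" "append_cols A B \<in> carrier_mat m (2 * m)"
    if "A \<in> HH_mat m" "B \<in> HH_mat m" for A B
  proof -
    have AB: "A \<in> carrier_mat m m" "B \<in> carrier_mat m m" using that by (auto simp: HH_mat_def)
    then show c: "append_cols A B \<in> carrier_mat m (2 * m)"
      unfolding mult_2 by (rule append_cols_carrier)
    have "append_cols A B $$ (i, j) \<in> HH" if "i < m" "j < m + m" for i j
      using append_cols_index[OF AB that] that \<open>A \<in> HH_mat m\<close> \<open>B \<in> HH_mat m\<close>
      by (simp add: HH_mat_iff)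
    then show "elements_mat (append_cols A B) \<subseteq> HH" using carrier_matD[OF c] by auto
  qed
  \<comment> \<open>The condition at \<open>s\<close> becomes the vanishing at \<open>s\<close> of a
    single matrix over the ring.\<close>
  have eval_eq: "append_cols (eval_mat A s) (eval_mat B s) * adj_mat (eval_mat M s) =
      eval_mat (append_cols A B * adj_mat M) s"
    if "A \<in> HH_mat m" "B \<in> HH_mat m" "s \<in> C_plus" for A B s
    using eval_mat_mult[OF that(3) app_HH(2)[OF that(1,2)] adj(2) app_HH(1)[OF that(1,2)]] that adj
    by (simp add: eval_mat_append_cols[of _ m m _ m] HH_mat_def adj_mat_eval_mat[OF that(3) MH])
  show ?thesis
  proof
    assume "\<exists>K. compensator m K \<and> proper_mat K \<and> simultaneously_stabilizes m K P0 P1"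
    then obtain K Nc Dc where K: "left_coprime_factorization m K Nc Dc"
      and st: "stabilizes m K P0" "stabilizes m K P1"
      unfolding compensator_def simultaneously_stabilizes_def by blast
    let ?\<Delta>0 = "Nc * N0 + Dc * D0" and ?\<Delta>1 = "Nc * N1 + Dc * D1"
    \<comment> \<open>Each \<open>stabilizes\<close> hides factorizations of its own; by
      \<open>stabilizes_iff\<close> the fixed \<open>Nc\<close>, \<open>Dc\<close> serve both
      plants.\<close>
    have u: "unimodular m ?\<Delta>0" "unimodular m ?\<Delta>1"
      using st stabilizes_iff[OF K assms(1)] stabilizes_iff[OF K assms(2)] by blast+
    have c: "Nc \<in> HH_mat m" "Dc \<in> HH_mat m"
      using K by (auto simp: left_coprime_factorization_def)
    note ac = app_HH[OF c]
    have "append_cols ?\<Delta>0 ?\<Delta>1 = append_cols Nc Dc * M"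
      unfolding assms(4) using append_cols_mult[of Nc m m Dc m N0 m N1 m D0 D1] C c
      by (simp add: HH_mat_def)
    then have "append_cols ?\<Delta>0 ?\<Delta>1 * adj_mat M = append_cols Nc Dc * (M * adj_mat M)"
      using assoc_mult_mat[OF ac(2) M adj(2)] by simp
    also have "\<dots> = ?d \<cdot>\<^sub>m append_cols Nc Dc"
      using ac(2) by (simp add: adj_mat(2)[OF M] mult_smult_distrib[OF ac(2), of _ "2 * m"])
    finally have eq: "append_cols ?\<Delta>0 ?\<Delta>1 * adj_mat M = ?d \<cdot>\<^sub>m append_cols Nc Dc" .
    have "append_cols (eval_mat ?\<Delta>0 s) (eval_mat ?\<Delta>1 s) * adj_mat (eval_mat M s) = 0\<^sub>m m (2 * m)"
      if s: "s \<in> zeros_in_C_plus ?d" for s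
    proof -
      have s': "s \<in> C_plus" "rat_eval ?d s = 0" using s by (auto simp: zeros_in_C_plus_def)
      have "rat_eval (?d * x) s = 0" if "x \<in> elements_mat (append_cols Nc Dc)" for x
        using rat_eval_mult[OF s'(1) det_HH[OF MH], of x] that ac(1) s'(2) by auto
      then have "eval_mat (?d \<cdot>\<^sub>m append_cols Nc Dc) s = 0\<^sub>m m (2 * m)"
        using ac(2) by (intro eq_matI) auto
      moreover have "?\<Delta>0 \<in> HH_mat m" "?\<Delta>1 \<in> HH_mat m" using u by (auto simp: unimodular_def)
      ultimately show ?thesis by (simp only: eval_eq[OF _ _ s'(1)] eq)
    qed
    then show "\<exists>\<Delta>0 \<Delta>1. unimodular m \<Delta>0 \<and> unimodular m \<Delta>1 \<and>
       (\<forall>s \<in> zeros_in_C_plus ?d.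
          append_cols (eval_mat \<Delta>0 s) (eval_mat \<Delta>1 s) * adj_mat (eval_mat M s) = 0\<^sub>m m (2 * m))"
      using u by blast
  next
    assume "\<exists>\<Delta>0 \<Delta>1. unimodular m \<Delta>0 \<and> unimodular m \<Delta>1 \<and>
       (\<forall>s \<in> zeros_in_C_plus ?d.
          append_cols (eval_mat \<Delta>0 s) (eval_mat \<Delta>1 s) * adj_mat (eval_mat M s) = 0\<^sub>m m (2 * m))"
    then obtain \<Delta>0 \<Delta>1 where u: "unimodular m \<Delta>0" "unimodular m \<Delta>1"
      and ze: "\<And>s. s \<in> zeros_in_C_plus ?d \<Longrightarrow>
        append_cols (eval_mat \<Delta>0 s) (eval_mat \<Delta>1 s) * adj_mat (eval_mat M s) = 0\<^sub>m m (2 * m)"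
      by blast
    have \<Delta>: "\<Delta>0 \<in> HH_mat m" "\<Delta>1 \<in> HH_mat m" using u by (auto simp: unimodular_def)
    have \<Delta>C: "\<Delta>0 \<in> carrier_mat m m" "\<Delta>1 \<in> carrier_mat m m" using \<Delta> by (auto simp: HH_mat_def)
    note a\<Delta> = app_HH[OF \<Delta>]
    \<comment> \<open>This has to equal \<open>det M\<close> times the block row
      \<open>[Nc Dc]\<close> to be found.\<close>
    define W where "W = append_cols \<Delta>0 \<Delta>1 * adj_mat M"
    have W: "W \<in> carrier_mat m (2 * m)" unfolding W_def using a\<Delta>(2) adj(2) by simp
    have d0: "?d \<noteq> 0" using assms(5) by (auto simp: rat_eval_0)
    \<comment> \<open>Each unstable zero of \<open>det M\<close> is finite and simple, so the zero
      of the entry of \<open>W\<close> at the same point cancels it.\<close>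
    have quot: "W $$ (i, j) / ?d \<in> HH" if ij: "i < m" "j < 2 * m" for i j
    proof (rule HH_divide[OF _ det_HH[OF MH] assms(5)])
      have "append_cols \<Delta>0 \<Delta>1 $$ (i, k) \<in> HH" "adj_mat M $$ (k, j) \<in> HH" if "k < 2 * m" for k
        using a\<Delta> adj(1) ij that by (blast, auto simp: HH_mat_iff)
      then show "W $$ (i, j) \<in> HH"
        unfolding W_def using a\<Delta>(2) adj(2) ij by (auto simp: scalar_prod_def intro!: HH_sum HH_mult)
    next
      fix z assume z: "Re z \<ge> 0" "rat_eval ?d (Fin z) = 0"
      then have zp: "Fin z \<in> zeros_in_C_plus ?d" "Fin z \<in> C_plus"
        by (auto simp: zeros_in_C_plus_def C_plus_def C_minus_def)
      have "eval_mat W (Fin z) = 0\<^sub>m m (2 * m)"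
        using ze[OF zp(1)] eval_eq[OF \<Delta> zp(2)] by (simp add: W_def)
      then have "eval_mat W (Fin z) $$ (i, j) = 0" using ij by simp
      then show "order z (numer ?d) = 1 \<and> rat_eval (W $$ (i, j)) (Fin z) = 0"
        using assms(6) zp(1) ij W by auto
    qed
    \<comment> \<open>The quotient is cut into its left and right halves; the columns of
      \<open>Dc\<close> start at offset \<open>m\<close>.\<close>
    define Nc where "Nc = mat m m (\<lambda>(i, j). W $$ (i, j) / ?d)"
    define Dc where "Dc = mat m m (\<lambda>(i, j). W $$ (i, m + j) / ?d)"
    have c: "Nc \<in> HH_mat m" "Dc \<in> HH_mat m"
      using quot by (auto simp: HH_mat_iff Nc_def Dc_def)
    then have cC: "Nc \<in> carrier_mat m m" "Dc \<in> carrier_mat m m" by (auto simp: HH_mat_def)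
    note ac = app_HH(2)[OF c]
    have "append_cols Nc Dc = (1 / ?d) \<cdot>\<^sub>m W"
    proof (rule eq_matI)
      fix i j assume "i < dim_row ((1 / ?d) \<cdot>\<^sub>m W)" "j < dim_col ((1 / ?d) \<cdot>\<^sub>m W)"
      then have "i < m" "j < m + m" using W by auto
      then show "append_cols Nc Dc $$ (i, j) = ((1 / ?d) \<cdot>\<^sub>m W) $$ (i, j)"
        using W append_cols_index[OF cC, of i j] by (auto simp: Nc_def Dc_def)
    qed (use ac W in auto)
    then have "append_cols Nc Dc * M = (1 / ?d) \<cdot>\<^sub>m (append_cols \<Delta>0 \<Delta>1 * (adj_mat M * M))"
      using mult_smult_assoc_mat[OF W M] assoc_mult_mat[OF a\<Delta>(2) adj(2) M] by (simp add: W_def)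
    also have "\<dots> = append_cols \<Delta>0 \<Delta>1"
    proof -
      have "append_cols \<Delta>0 \<Delta>1 * (adj_mat M * M) = ?d \<cdot>\<^sub>m append_cols \<Delta>0 \<Delta>1"
        using a\<Delta>(2) by (simp add: adj_mat(3)[OF M] mult_smult_distrib[OF a\<Delta>(2), of _ "2 * m"])
      then show ?thesis using d0 by (intro eq_matI) auto
    qed
    finally have "append_cols (Nc * N0 + Dc * D0) (Nc * N1 + Dc * D1) = append_cols \<Delta>0 \<Delta>1"
      unfolding assms(4) by (simp add: append_cols_mult[OF cC C(1,3,2,4)])
    from append_cols_inject[OF _ _ _ _ this, of m m m] cC C \<Delta>C
    have eqs: "Nc * N0 + Dc * D0 = \<Delta>0" "Nc * N1 + Dc * D1 = \<Delta>1" by auto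

    \<comment> \<open>Since \<open>Dc\<close> may be singular at infinity, it is shifted by a
      multiple of the identity that is small enough for both plants.\<close>
    obtain \<delta>0 where \<delta>0: "\<delta>0 > 0"
      "\<And>\<epsilon>. 0 < \<epsilon> \<Longrightarrow> \<epsilon> < \<delta>0 \<Longrightarrow> unimodular m (\<Delta>0 + to_fract [:\<epsilon>:] \<cdot>\<^sub>m D0)"
      using unimodular_perturb[OF u(1) H(2)] by blast
    obtain \<delta>1 where \<delta>1: "\<delta>1 > 0"
      "\<And>\<epsilon>. 0 < \<epsilon> \<Longrightarrow> \<epsilon> < \<delta>1 \<Longrightarrow> unimodular m (\<Delta>1 + to_fract [:\<epsilon>:] \<cdot>\<^sub>m D1)"
      using unimodular_perturb[OF u(2) H(4)] by blast
    have inf: "Infinity \<in> C_plus" by (simp add: C_plus_def)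
    have "finite {\<epsilon>. det (eval_mat Dc Infinity + complex_of_real \<epsilon> \<cdot>\<^sub>m 1\<^sub>m m) = 0}"
      using cC by (intro finite_singular_shifts) simp
    moreover have "infinite {0<..<min \<delta>0 \<delta>1}" using \<delta>0(1) \<delta>1(1) by (simp add: infinite_Ioo)
    \<comment> \<open>An infinite interval of admissible shifts cannot be exhausted by the finitely
      many singular ones.\<close>
    ultimately have "{0<..<min \<delta>0 \<delta>1} -
        {\<epsilon>. det (eval_mat Dc Infinity + complex_of_real \<epsilon> \<cdot>\<^sub>m 1\<^sub>m m) = 0} \<noteq> {}"
      by (intro infinite_imp_nonempty Diff_infinite_finite)
    then obtain \<epsilon> where "\<epsilon> \<in> {0<..<min \<delta>0 \<delta>1} -
        {\<epsilon>. det (eval_mat Dc Infinity + complex_of_real \<epsilon> \<cdot>\<^sub>m 1\<^sub>m m) = 0}" by blast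
    then have \<epsilon>: "0 < \<epsilon>" "\<epsilon> < \<delta>0" "\<epsilon> < \<delta>1"
      and ns: "det (eval_mat Dc Infinity + complex_of_real \<epsilon> \<cdot>\<^sub>m 1\<^sub>m m) \<noteq> 0"
      by auto
    let ?e = "to_fract [:\<epsilon>:]"
    define Dc' where "Dc' = Dc + ?e \<cdot>\<^sub>m 1\<^sub>m m"
    have Dc': "Dc' \<in> HH_mat m" unfolding Dc'_def
      by (intro HH_mat_add c) (auto simp: HH_mat_iff HH_0 HH_const)
    have shift: "Nc * N + Dc' * D = (Nc * N + Dc * D) + ?e \<cdot>\<^sub>m D"
      if "N \<in> carrier_mat m m" "D \<in> carrier_mat m m" for N D
      unfolding Dc'_def using that cC
      by (simp add: add_mult_distrib_mat[of _ m m] mult_smult_assoc_mat[of _ m m] assoc_add_mat[of _ m m])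
    have u': "unimodular m (Nc * N0 + Dc' * D0)" "unimodular m (Nc * N1 + Dc' * D1)"
      using \<delta>0(2) \<delta>1(2) \<epsilon> C by (simp_all add: shift eqs)
    have "eval_mat Dc' Infinity = eval_mat Dc Infinity + complex_of_real \<epsilon> \<cdot>\<^sub>m 1\<^sub>m m"
      using c(2) by (intro eq_matI) (auto simp: Dc'_def HH_mat_iff rat_eval_add[OF inf]
          HH_0 HH_const rat_eval_const[OF inf] rat_eval_0)
    then have "rat_eval (det Dc') Infinity \<noteq> 0" using ns det_eval_mat[OF inf Dc'] by simp
    \<comment> \<open>Left coprimeness of \<open>Nc\<close> and \<open>Dc'\<close> comes from their
      unimodular combination with the factors of the first plant.\<close>
    then obtain K where K: "left_coprime_factorization m K Nc Dc'" "proper_mat K"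
      using proper_compensator[OF c(1) Dc' left_coprime_if_unimodular_combination[OF H(1,2) u'(1)]]
      by blast
    then show "\<exists>K. compensator m K \<and> proper_mat K \<and> simultaneously_stabilizes m K P0 P1"
      unfolding compensator_def simultaneously_stabilizes_def
      using stabilizes_iff[OF K(1) assms(1)] stabilizes_iff[OF K(1) assms(2)] u' by blast
  qed
qed

end
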